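(* Let $G$ be an Abelian group, $A \subseteq G$ a finite set with $|A| = m \ge 2$, $p$ a positive integer, $k=2^p$, and $\zeta=\zeta_k(A)$. Let $\beta_1, \beta_2 \in (0,1)$ with $\beta_1 \le \beta_2$, and let $C\in(0,1/32]$. Then there exists a set $A' \subseteq A$ such that: (1) for every $B\subseteq A'$ with $\beta_1|A'|\le |B|\le\beta_2|A'|$ one has $T_k(B)\ge C^{2k}(|B|/|A'|)^{2k}T_k(A')$; (2) $|A'| \ge m \cdot 2^{\frac{\log ( (2k-1)/ \zeta)}{\log (1+\kappa)} \log (1-\beta_2)}$, where $\kappa = \frac{\log ((1-\beta_1)^{-1})}{\log m} (1-16 C)$; (3) $\zeta_k (A') \ge \zeta_k (A)$.
   Context: $\log$ denotes the logarithm to base $2$. For a finite set $A$ and integer $k\ge2$, $T_k(A)$ is the number of $2k$-tuples $(a_1,\dots,a_k,a'_1,\dots,a'_k)\in A^{2k}$ with $a_1+\dots+a_k=a'_1+\dots+a'_k$. For $|A|\ge2$, $\zeta_k(A)=\log T_k(A)/\log|A|$. *)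

theory Defs
  imports Complex_Main
begin

definition T_energy :: "nat \<Rightarrow> 'a::ab_group_add set \<Rightarrow> nat" where
  "T_energy k A = card {(xs, ys). length xs = k \<and> length ys = k \<and>
     set xs \<subseteq> A \<and> set ys \<subseteq> A \<and> sum_list xs = sum_list ys}"

text \<open>
  Intended for sets with at least two elements.  For smaller sets the value is \<open>0\<close>, since
  \<open>log 2 0 = log 2 1 = 0\<close> and \<open>x / 0 = 0\<close>.
\<close>

definition zeta_exp :: "nat \<Rightarrow> 'a::ab_group_add set \<Rightarrow> real" where
  "zeta_exp k A = log 2 (real (T_energy k A)) / log 2 (real (card A))"

end

theory Submission
  imports Defs "HOL-Library.Poly_Mapping" "HOL-Analysis.Convex"
begin

text \<open>
  For even \<open>k\<close> the quantity \<open>T\<^sub>k(A)\<close> raised to the power \<open>1/2k\<close> satisfies the triangle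
  inequality.  Indeed \<open>T\<^sub>k(A)\<close> is the squared \<open>l\<^sup>2\<close> norm of the \<open>k\<close>-th power of the indicator
  of \<open>A\<close> in the real group ring, and Cauchy--Schwarz makes the norms of the mixed monomials
  \<open>1\<^sub>B\<^sup>i 1\<^sub>D\<^sup>k\<^sup>-\<^sup>i\<close> log-convex in \<open>i\<close>, so that the binomial theorem applies.

  Hence, if \<open>B \<subseteq> A\<close> violates the required lower bound on the energy, then \<open>A - B\<close> keeps
  nearly all the energy of \<open>A\<close> while being smaller, and its exponent \<open>\<zeta>\<close> is larger by a
  factor of at least \<open>1 + \<kappa>\<close>.  Since \<open>\<zeta>\<close> never exceeds \<open>2k - 1\<close>, removing bad sets stops
  after at most \<open>log ((2k - 1) / \<zeta>) / log (1 + \<kappa>)\<close> steps, and each step keeps a proportion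
  of at least \<open>1 - \<beta>\<^sub>2\<close> of the elements.
\<close>

section \<open>The real group ring, reflection and the inner product\<close>

definition reflect :: "('a::ab_group_add \<Rightarrow>\<^sub>0 real) \<Rightarrow> 'a \<Rightarrow>\<^sub>0 real" where
  "reflect P = Poly_Mapping.map_key uminus P"

lemma reflect_add: "reflect (P + Q) = reflect P + reflect Q"
  by (simp add: reflect_def Poly_Mapping.map_key_plus)

lemma reflect_zero [simp]: "reflect 0 = 0"
  by (simp add: reflect_def)

lemma reflect_single [simp]: "reflect (Poly_Mapping.single x c) = Poly_Mapping.single (- x) c"
  using Poly_Mapping.map_key_single[OF inj_uminus, of "- x" c] by (simp add: reflect_def)

lemma reflect_sum: "reflect (sum f S) = (\<Sum>x\<in>S. reflect (f x))"
  by (induction S rule: infinite_finite_induct) (simp_all add: reflect_add)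

lemma lookup_reflect: "poly_mapping.lookup (reflect P) x = poly_mapping.lookup P (- x)"
  unfolding reflect_def by (simp add: Poly_Mapping.map_key.rep_eq)

lemma reflect_reflect [simp]: "reflect (reflect P) = P"
  by (rule poly_mapping_eqI) (simp add: lookup_reflect)

text \<open>The index set may exceed the support, so that two elements can be expanded over a common
  set.\<close>

lemma poly_mapping_eq_sum_single:
  assumes "finite S" "Poly_Mapping.keys P \<subseteq> S"
  shows "P = (\<Sum>x\<in>S. Poly_Mapping.single x (poly_mapping.lookup P x))"
proof (rule poly_mapping_eqI)
  fix y
  have "poly_mapping.lookup P y = (\<Sum>x\<in>S. if x = y then poly_mapping.lookup P x else 0)"
    using assms by (auto simp: sum.delta in_keys_iff)
  also have "\<dots> = poly_mapping.lookup (\<Sum>x\<in>S. Poly_Mapping.single x (poly_mapping.lookup P x)) y"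
    by (simp add: lookup_sum lookup_single when_def)
  finally show "poly_mapping.lookup P y = poly_mapping.lookup (\<Sum>x\<in>S. Poly_Mapping.single x (poly_mapping.lookup P x)) y" .
qed

text \<open>On single terms this is \<open>- (x + y) = - x + - y\<close>; expanding both factors
  extends it bilinearly.\<close>

lemma reflect_mult: "reflect (P * Q) = reflect P * reflect Q"
proof -
  have "reflect (P * Q) = reflect ((\<Sum>x\<in>Poly_Mapping.keys P. Poly_Mapping.single x (poly_mapping.lookup P x)) *
      (\<Sum>x\<in>Poly_Mapping.keys Q. Poly_Mapping.single x (poly_mapping.lookup Q x)))"
    using poly_mapping_eq_sum_single[of "Poly_Mapping.keys P" P] poly_mapping_eq_sum_single[of "Poly_Mapping.keys Q" Q] by simp
  also have "\<dots> = reflect (\<Sum>x\<in>Poly_Mapping.keys P. Poly_Mapping.single x (poly_mapping.lookup P x)) *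
      reflect (\<Sum>x\<in>Poly_Mapping.keys Q. Poly_Mapping.single x (poly_mapping.lookup Q x))"
    by (simp add: reflect_sum sum_product mult_single)
  also have "\<dots> = reflect P * reflect Q"
    using poly_mapping_eq_sum_single[of "Poly_Mapping.keys P" P] poly_mapping_eq_sum_single[of "Poly_Mapping.keys Q" Q] by simp
  finally show ?thesis .
qed

text \<open>This is the usual l2 inner product (see \<open>inprod_eq_sum\<close>). As a coefficient
  of a product it lets factors move between the two arguments, up to reflection, by commutativity
  alone.\<close>

definition inprod :: "('a::ab_group_add \<Rightarrow>\<^sub>0 real) \<Rightarrow> ('a \<Rightarrow>\<^sub>0 real) \<Rightarrow> real" where
  "inprod P Q = poly_mapping.lookup (P * reflect Q) 0"

lemma inprod_add_left: "inprod (P + P') Q = inprod P Q + inprod P' Q"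
  by (simp add: inprod_def distrib_right lookup_add)

lemma inprod_add_right: "inprod P (Q + Q') = inprod P Q + inprod P Q'"
  by (simp add: inprod_def reflect_add distrib_left lookup_add)

lemma inprod_sum: "inprod (sum f S) (sum g R) = (\<Sum>x\<in>S. \<Sum>y\<in>R. inprod (f x) (g y))"
  by (simp add: inprod_def reflect_sum sum_product lookup_sum)

lemma inprod_single:
  "inprod (Poly_Mapping.single x c) (Poly_Mapping.single y d) = (if x = y then c * d else 0)"
  by (auto simp: inprod_def mult_single lookup_single when_def)

lemma inprod_eq_sum:
  assumes "finite S" "Poly_Mapping.keys P \<subseteq> S" "Poly_Mapping.keys Q \<subseteq> S"
  shows "inprod P Q = (\<Sum>x\<in>S. poly_mapping.lookup P x * poly_mapping.lookup Q x)"
proof -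
  have "inprod P Q = inprod (\<Sum>x\<in>S. Poly_Mapping.single x (poly_mapping.lookup P x))
      (\<Sum>x\<in>S. Poly_Mapping.single x (poly_mapping.lookup Q x))"
    using poly_mapping_eq_sum_single assms by metis
  then show ?thesis
    using assms(1) by (simp add: inprod_sum inprod_single sum.delta)
qed

lemma inprod_nonneg: "0 \<le> inprod P P"
  by (simp add: inprod_eq_sum[of "Poly_Mapping.keys P"] sum_nonneg)

lemma inprod_commute: "inprod P Q = inprod Q P"
  by (simp add: inprod_eq_sum[of "Poly_Mapping.keys P \<union> Poly_Mapping.keys Q"] mult.commute)

lemma inprod_Cauchy_Schwarz: "(inprod P Q)\<^sup>2 \<le> inprod P P * inprod Q Q"
  using Cauchy_Schwarz_ineq_sum[of "poly_mapping.lookup P" "poly_mapping.lookup Q" "Poly_Mapping.keys P \<union> Poly_Mapping.keys Q"]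
  by (simp add: inprod_eq_sum[of "Poly_Mapping.keys P \<union> Poly_Mapping.keys Q"] power2_eq_square)

section \<open>The l2 norm, its triangle inequality and the log-convexity of mixed monomials\<close>

definition l2norm :: "('a::ab_group_add \<Rightarrow>\<^sub>0 real) \<Rightarrow> real" where
  "l2norm P = sqrt (inprod P P)"

lemma l2norm_nonneg [simp]: "0 \<le> l2norm P"
  by (simp add: l2norm_def inprod_nonneg)

lemma l2norm_power2: "(l2norm P)\<^sup>2 = inprod P P"
  by (simp add: l2norm_def inprod_nonneg)

lemma inprod_le_l2norm: "inprod P Q \<le> l2norm P * l2norm Q"
proof -
  have "\<bar>inprod P Q\<bar> \<le> sqrt (inprod P P * inprod Q Q)"
    using inprod_Cauchy_Schwarz[of P Q] by (simp add: real_le_rsqrt)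
  then show ?thesis
    by (simp add: l2norm_def real_sqrt_mult)
qed

lemma l2norm_zero [simp]: "l2norm 0 = 0"
  by (simp add: l2norm_def inprod_def)

lemma l2norm_triangle: "l2norm (P + Q) \<le> l2norm P + l2norm Q"
proof (rule power2_le_imp_le)
  have "(l2norm (P + Q))\<^sup>2 = (l2norm P)\<^sup>2 + 2 * inprod P Q + (l2norm Q)\<^sup>2"
    by (simp add: l2norm_power2 inprod_add_left inprod_add_right inprod_commute[of Q P])
  also have "\<dots> \<le> (l2norm P + l2norm Q)\<^sup>2"
    using inprod_le_l2norm[of P Q] by (simp add: power2_sum)
  finally show "(l2norm (P + Q))\<^sup>2 \<le> (l2norm P + l2norm Q)\<^sup>2" .
qed simp

lemma l2norm_sum: "l2norm (sum f S) \<le> (\<Sum>x\<in>S. l2norm (f x))"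
proof (induction S rule: infinite_finite_induct)
  case (insert x S)
  then show ?case
    using l2norm_triangle[of "f x" "sum f S"] by simp
qed simp_all

text \<open>Scalars act as multiples of the ring unit; the binomial coefficients will enter in this
  form.\<close>

lemma l2norm_single_mult: "l2norm (Poly_Mapping.single 0 c * P) = \<bar>c\<bar> * l2norm P"
proof -
  have "inprod (Poly_Mapping.single 0 c * P) (Poly_Mapping.single 0 c * P) =
      poly_mapping.lookup (Poly_Mapping.single 0 c * Poly_Mapping.single 0 c * (P * reflect P)) 0"
    by (simp add: inprod_def reflect_mult) (simp only: mult_ac)
  also have "\<dots> = c\<^sup>2 * inprod P P"
    by (simp add: inprod_def power2_eq_square mult_single flip: mult_map_scale_conv_mult)
       (simp add: Poly_Mapping.map.rep_eq when_def)
  finally show ?thesis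
    by (simp add: l2norm_def real_sqrt_mult)
qed

text \<open>
  The energy of \<open>P * Q\<close> counts solutions of \<open>x + y = x' + y'\<close>; writing this as
  \<open>x - x' = y' - y\<close> separates \<open>P\<close> from \<open>Q\<close>, and in each factor the signs may be moved back.
\<close>
lemma l2norm_mult_power2_le: "(l2norm (P * Q))\<^sup>2 \<le> l2norm (P * P) * l2norm (Q * Q)"
proof -
  have eq: "l2norm (R * reflect R) = l2norm (R * R)" for R :: "'a \<Rightarrow>\<^sub>0 real"
    by (simp add: l2norm_def inprod_def reflect_mult mult_ac)
  have "(l2norm (P * Q))\<^sup>2 = inprod (P * reflect P) (Q * reflect Q)"
    by (simp add: l2norm_power2 inprod_def reflect_mult mult_ac)
  also have "\<dots> \<le> l2norm (P * reflect P) * l2norm (Q * reflect Q)"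
    by (rule inprod_le_l2norm)
  finally show ?thesis
    by (simp only: eq)
qed

text \<open>
  Midpoint convexity is only available with even outer indices, so a maximiser \<open>j\<close> is compared
  with \<open>j \<plusminus> 1\<close> or \<open>j \<plusminus> 2\<close> according to parity; the least maximiser gives a contradiction.
\<close>
lemma le_one_of_midpoint_log_convex:
  fixes c :: "nat \<Rightarrow> real"
  assumes nonneg: "\<And>i. 0 \<le> c i" and "c 0 \<le> 1" and "c (2 * h) \<le> 1"
    and mid: "\<And>i j. i \<le> h \<Longrightarrow> j \<le> h \<Longrightarrow> (c (i + j))\<^sup>2 \<le> c (2 * i) * c (2 * j)"
    and "i \<le> 2 * h"
  shows "c i \<le> 1"
proof (rule ccontr)
  assume "\<not> c i \<le> 1"
  define M where "M = Max (c ` {..2 * h})"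
  have le: "c j \<le> M" if "j \<le> 2 * h" for j
    using that by (simp add: M_def)
  have M: "M > 1"
    using le[OF \<open>i \<le> 2 * h\<close>] \<open>\<not> c i \<le> 1\<close> by linarith
  have "M \<in> c ` {..2 * h}"
    unfolding M_def by (rule Max_in) auto
  then have ex: "\<exists>j. j \<le> 2 * h \<and> c j = M"
    by auto
  define j where "j = (LEAST j. j \<le> 2 * h \<and> c j = M)"
  have j: "j \<le> 2 * h" "c j = M"
    using LeastI_ex[OF ex] by (simp_all add: j_def)
  have lt: "c l < M" if "l < j" for l
  proof -
    have "\<not> (l \<le> 2 * h \<and> c l = M)"
      using that unfolding j_def by (rule not_less_Least)
    then show ?thesis
      using that j(1) le[of l] by (simp add: less_le)
  qed
  \<comment> \<open>The values at both ends are at most 1 < \<open>M\<close>, so the maximiser is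
    interior. This keeps \<open>r\<close> and \<open>s\<close> below within
    \<open>{0..h}\<close>.\<close>
  have j0: "j \<noteq> 0" "j \<noteq> 2 * h"
    using j(2) M assms(2,3) by (metis not_less)+
  obtain r s where rs: "r \<le> h" "s \<le> h" "r + s = j" "2 * r < j"
  proof (cases "even j")
    case True
    then obtain q where "j = 2 * q" ..
    with j j0 show thesis
      by (intro that[of "q - 1" "q + 1"]) auto
  next
    case False
    then obtain q where "j = 2 * q + 1" ..
    with j j0 show thesis
      by (intro that[of q "q + 1"]) auto
  qed
  have "M * M \<le> c (2 * r) * c (2 * s)"
    using mid[OF rs(1,2)] rs(3) j by (simp add: power2_eq_square)
  also have "\<dots> \<le> c (2 * r) * M"
    using le[of "2 * s"] rs nonneg by (intro mult_left_mono) auto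
  also have "\<dots> < M * M"
    using lt[OF rs(4)] M by simp
  finally show False
    by simp
qed

text \<open>Dividing by the geometric weights \<open>b ^ i * d ^ (k - i)\<close> preserves midpoint
  log-convexity and makes both end values 1, so \<open>le_one_of_midpoint_log_convex\<close>
  applies. As \<open>k = 2 * h\<close>, each monomial involved splits into two factors of degree
  \<open>h\<close>, which is the shape required by \<open>l2norm_mult_power2_le\<close>.\<close>

lemma l2norm_mixed_power_le:
  assumes "k = 2 * h" and "0 < b" and "0 < d"
    and "l2norm (P ^ k) = b ^ k" and "l2norm (Q ^ k) = d ^ k" and "i \<le> k"
  shows "l2norm (P ^ i * Q ^ (k - i)) \<le> b ^ i * d ^ (k - i)"
proof -
  define c where "c i = l2norm (P ^ i * Q ^ (k - i)) / (b ^ i * d ^ (k - i))" for i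
  have "c i \<le> 1"
  proof (rule le_one_of_midpoint_log_convex[of c h])
    fix i j assume ij: "i \<le> h" "j \<le> h"
    define W where "W = b ^ (i + j) * d ^ (k - (i + j))"
    have "P ^ (i + j) * Q ^ (k - (i + j)) = (P ^ i * Q ^ (h - i)) * (P ^ j * Q ^ (h - j))"
    proof -
      have "k - (i + j) = (h - i) + (h - j)"
        using ij assms(1) by simp
      then show ?thesis
        by (simp only: power_add mult_ac)
    qed
    moreover have "P ^ (2 * i) * Q ^ (k - 2 * i) = (P ^ i * Q ^ (h - i)) * (P ^ i * Q ^ (h - i))"
      if "i \<le> h" for i
    proof -
      have "k - 2 * i = (h - i) + (h - i)"
        using that assms(1) by simp
      then show ?thesis
        by (simp only: power_add power_even_eq power2_eq_square) (simp only: mult_ac)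
    qed
    ultimately have main: "(l2norm (P ^ (i + j) * Q ^ (k - (i + j))))\<^sup>2
        \<le> l2norm (P ^ (2 * i) * Q ^ (k - 2 * i)) * l2norm (P ^ (2 * j) * Q ^ (k - 2 * j))"
      using l2norm_mult_power2_le ij by metis
    have "(b ^ (2 * i) * d ^ (k - 2 * i)) * (b ^ (2 * j) * d ^ (k - 2 * j)) = W\<^sup>2"
    proof -
      have e: "(k - 2 * i) + (k - 2 * j) = 2 * (k - (i + j))"
        using ij assms(1) by simp
      have "(b ^ (2 * i) * d ^ (k - 2 * i)) * (b ^ (2 * j) * d ^ (k - 2 * j))
          = b ^ (2 * (i + j)) * d ^ ((k - 2 * i) + (k - 2 * j))"
        by (simp only: power_add distrib_left) (simp only: mult_ac)
      then show ?thesis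
        unfolding e W_def by (simp only: power_even_eq power_mult_distrib)
    qed
    then show "(c (i + j))\<^sup>2 \<le> c (2 * i) * c (2 * j)"
      using main assms by (simp add: c_def power_divide divide_right_mono W_def)
  qed (use assms in \<open>auto simp: c_def\<close>)
  then show ?thesis
    using assms by (simp add: c_def)
qed

section \<open>Energy as the norm of a power of the indicator; trivial bounds and the triangle
  inequality\<close>

definition ind :: "'a::ab_group_add set \<Rightarrow> 'a \<Rightarrow>\<^sub>0 real" where
  "ind A = (\<Sum>a\<in>A. Poly_Mapping.single a 1)"

text \<open>Collecting terms, the coefficient at \<open>x\<close> counts the \<open>k\<close>-tuples
  from \<open>A\<close> with sum \<open>x\<close>. The sum is left indexed by lists to match
  \<open>T_energy\<close>.\<close>

lemma ind_power:
  "ind A ^ k = (\<Sum>xs | set xs \<subseteq> A \<and> length xs = k. Poly_Mapping.single (sum_list xs) 1)"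
proof (induction k)
  case 0
  have "{xs. set xs \<subseteq> A \<and> length xs = 0} = {[]}"
    by auto
  then show ?case
    by simp
next
  case (Suc k)
  have "ind A ^ Suc k = (\<Sum>xs | set xs \<subseteq> A \<and> length xs = k. \<Sum>a\<in>A.
      Poly_Mapping.single (sum_list xs) 1 * Poly_Mapping.single a 1)"
    by (simp only: power_Suc2 Suc) (simp only: ind_def sum_product)
  also have "\<dots> = (\<Sum>(xs, a)\<in>{xs. set xs \<subseteq> A \<and> length xs = k} \<times> A.
      Poly_Mapping.single (sum_list (a # xs)) 1)"
    by (simp add: mult_single sum.cartesian_product add.commute)
  also have "\<dots> = (\<Sum>xs | set xs \<subseteq> A \<and> length xs = Suc k. Poly_Mapping.single (sum_list xs) 1)"
    unfolding lists_length_Suc_eq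
    by (subst sum.reindex) (auto simp: inj_on_def case_prod_unfold)
  finally show ?case .
qed

text \<open>By \<open>inprod_single\<close>, a pair of lists contributes 1 to the inner product
  exactly when the sums agree.\<close>

lemma T_energy_eq_l2norm:
  assumes "finite A"
  shows "real (T_energy k A) = (l2norm (ind A ^ k))\<^sup>2"
proof -
  define X where "X = {xs. set xs \<subseteq> A \<and> length xs = k}"
  have fin: "finite X"
    unfolding X_def by (rule finite_lists_length_eq[OF assms])
  have "T_energy k A = card (SIGMA xs:X. {ys\<in>X. sum_list xs = sum_list ys})"
    unfolding T_energy_def X_def by (rule arg_cong[where f = card]) auto
  then have "real (T_energy k A) = (\<Sum>xs\<in>X. \<Sum>ys\<in>X. if sum_list xs = sum_list ys then 1 else 0)"
    using fin by (simp add: card_SigmaI flip: sum.inter_filter)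
  then show ?thesis
    by (simp add: l2norm_power2 ind_power inprod_sum inprod_single cong: if_cong flip: X_def)
qed

text \<open>The diagonal pairs \<open>(xs, xs)\<close> are solutions.\<close>

lemma T_energy_ge:
  assumes "finite A"
  shows "card A ^ k \<le> T_energy k A"
proof -
  define X where "X = {xs. set xs \<subseteq> A \<and> length xs = k}"
  have fin: "finite X" and card: "card X = card A ^ k"
    using assms by (simp_all add: X_def finite_lists_length_eq card_lists_length_eq)
  have "card ((\<lambda>xs. (xs, xs)) ` X) \<le> T_energy k A"
    unfolding T_energy_def
    by (rule card_mono, rule finite_subset[of _ "X \<times> X"]) (use fin in \<open>auto simp: X_def\<close>)
  then show ?thesis
    by (simp add: card_image inj_on_def card)
qed

text \<open>The equation determines the first entry of \<open>ys\<close> from all the other entries;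
  this entry exists because \<open>k\<close> is positive.\<close>

lemma T_energy_le:
  assumes "finite A" and "0 < k"
  shows "T_energy k A \<le> card A ^ (2 * k - 1)"
proof -
  define X where "X l = {xs. set xs \<subseteq> A \<and> length xs = l}" for l
  have fin: "finite (X l)" and card: "card (X l) = card A ^ l" for l
    using assms by (simp_all add: X_def finite_lists_length_eq card_lists_length_eq)
  define E where "E = {(xs, ys). length xs = k \<and> length ys = k \<and>
     set xs \<subseteq> A \<and> set ys \<subseteq> A \<and> sum_list xs = sum_list ys}"
  have "inj_on (\<lambda>(xs, ys). (xs, tl ys)) E"
  proof (rule inj_onI)
    fix p q
    assume pq: "p \<in> E" "q \<in> E" "(\<lambda>(xs, ys). (xs, tl ys)) p = (\<lambda>(xs, ys). (xs, tl ys)) q"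
    then obtain xs ys ys' where eq: "p = (xs, ys)" "q = (xs, ys')" "tl ys = tl ys'"
      by (cases p; cases q) auto
    with pq have *: "(xs, ys) \<in> E" "(xs, ys') \<in> E" "tl ys = tl ys'"
      by auto
    obtain y zs where ys: "ys = y # zs"
      using * assms(2) by (cases ys) (auto simp: E_def)
    obtain y' zs' where ys': "ys' = y' # zs'"
      using * assms(2) by (cases ys') (auto simp: E_def)
    have "sum_list ys = sum_list ys'"
      using * by (simp add: E_def)
    then show "p = q"
      using * ys ys' eq by simp
  qed
  moreover have "(\<lambda>(xs, ys). (xs, tl ys)) ` E \<subseteq> X k \<times> X (k - 1)"
    by (auto simp: E_def X_def dest: list.set_sel(2)[rotated])
       (metis assms(2) length_greater_0_conv list.set_sel(2) subsetD)
  ultimately have "card E \<le> card (X k \<times> X (k - 1))"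
    using fin by (intro card_inj_on_le[where f = "\<lambda>(xs, ys). (xs, tl ys)"]) auto
  also have "\<dots> = card A ^ (2 * k - 1)"
    using assms(2) by (simp add: card_cartesian_product card mult_2 flip: power_add)
  finally show ?thesis
    by (simp add: T_energy_def E_def)
qed

lemma T_energy_pos:
  assumes "finite A" and "A \<noteq> {}"
  shows "0 < T_energy k A"
  using T_energy_ge[OF assms(1), of k] assms by (metis card_gt_0_iff gr0I le_zero_eq power_eq_0_iff)

lemma T_energy_root_triangle:
  fixes B D :: "'a::ab_group_add set"
  assumes "finite B" "finite D" "B \<inter> D = {}" "B \<noteq> {}" "D \<noteq> {}" and "even k" "0 < k"
  shows "root (2 * k) (T_energy k (B \<union> D)) \<le> root (2 * k) (T_energy k B) + root (2 * k) (T_energy k D)"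
proof -
  define b d where "b = root (2 * k) (T_energy k B)" and "d = root (2 * k) (T_energy k D)"
  have pos: "0 < b" "0 < d"
    using assms by (simp_all add: b_def d_def T_energy_pos)
  have pow: "b ^ k = l2norm (ind B ^ k)" "d ^ k = l2norm (ind D ^ k)"
  proof -
    \<comment> \<open>The energy is already the square of a norm, so a root of order
      \<open>2 * k\<close> corresponds to \<open>k\<close>-th powers on the level of norms.\<close>
    have "(b ^ k)\<^sup>2 = T_energy k B" "(d ^ k)\<^sup>2 = T_energy k D"
      unfolding power_even_eq[symmetric] using assms by (simp_all add: b_def d_def)
    then show "b ^ k = l2norm (ind B ^ k)" "d ^ k = l2norm (ind D ^ k)"
      using assms pos by (simp_all add: T_energy_eq_l2norm power2_eq_iff_nonneg)
  qed
  obtain h where h: "k = 2 * h"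
    using \<open>even k\<close> ..
  have "ind (B \<union> D) ^ k = (ind B + ind D) ^ k"
    using assms by (simp add: ind_def sum.union_disjoint)
  \<comment> \<open>The group ring is commutative, so the binomial theorem holds in it; after the
    mixed monomials are bounded, the same theorem over the reals reassembles
    \<open>(b + d) ^ k\<close>.\<close>
  also have "\<dots> = (\<Sum>i\<le>k. Poly_Mapping.single 0 (real (k choose i)) * (ind B ^ i * ind D ^ (k - i)))"
    by (simp add: binomial_ring single_of_nat mult.assoc)
  finally have "l2norm (ind (B \<union> D) ^ k) \<le>
      (\<Sum>i\<le>k. l2norm (Poly_Mapping.single 0 (real (k choose i)) * (ind B ^ i * ind D ^ (k - i))))"
    by (simp only: l2norm_sum)
  also have "\<dots> \<le> (\<Sum>i\<le>k. real (k choose i) * (b ^ i * d ^ (k - i)))"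
    using l2norm_mixed_power_le[OF h pos pow[symmetric]]
    by (intro sum_mono) (simp add: l2norm_single_mult mult_left_mono del: single_of_nat)
  also have "\<dots> = (b + d) ^ k"
    by (simp add: binomial_ring mult.assoc)
  finally have "(l2norm (ind (B \<union> D) ^ k))\<^sup>2 \<le> ((b + d) ^ k)\<^sup>2"
    by (intro power_mono) simp_all
  then have "real (T_energy k (B \<union> D)) \<le> (b + d) ^ (2 * k)"
    using assms by (simp add: T_energy_eq_l2norm power_mult[symmetric] mult.commute)
  then have "root (2 * k) (T_energy k (B \<union> D)) \<le> root (2 * k) ((b + d) ^ (2 * k))"
    using assms by simp
  also have "\<dots> = b + d"
    using pos assms by (intro real_root_power_cancel) simp_all
  finally show ?thesis
    by (simp add: b_def d_def)
qed

section \<open>The range of the exponent and its growth when a bad subset is removed\<close>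

lemma zeta_exp_ge:
  assumes "finite A" and "2 \<le> card A"
  shows "real k \<le> zeta_exp k A"
proof -
  have "real k * log 2 (card A) = log 2 (card A ^ k)"
    using assms by (simp add: log_nat_power)
  also have "\<dots> \<le> log 2 (T_energy k A)"
    using assms T_energy_ge[OF assms(1), of k] of_nat_mono[OF T_energy_ge[OF assms(1), of k], where 'a=real]
    by (intro log_mono) auto
  finally show ?thesis
    using assms by (simp add: zeta_exp_def pos_le_divide_eq)
qed

lemma zeta_exp_le:
  assumes "finite A" and "2 \<le> card A" and "0 < k"
  shows "zeta_exp k A \<le> 2 * real k - 1"
proof -
  have "A \<noteq> {}"
    using assms by auto
  then have "log 2 (T_energy k A) \<le> log 2 (card A ^ (2 * k - 1))"
    using T_energy_pos[OF assms(1), of k] of_nat_mono[OF T_energy_le[OF assms(1,3)], where 'a=real]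
    by (intro log_mono) auto
  also have "\<dots> = (2 * real k - 1) * log 2 (card A)"
    using assms by (simp add: log_nat_power of_nat_diff)
  finally show ?thesis
    using assms by (simp add: zeta_exp_def pos_divide_le_eq)
qed

text \<open>In the application \<open>t\<close> and \<open>u\<close> are the logarithms of the
  energies before and after a removal, \<open>M\<close> and \<open>M - L\<close> those of the
  cardinalities, and \<open>r\<close> is \<open>k\<close>. Since \<open>r * M <= t\<close>, the
  numerator loses at most the proportion \<open>4 * C * L / M\<close>, while the denominator loses
  the larger proportion \<open>L / M\<close>, so the quotient grows.\<close>

lemma exponent_growth:
  fixes t u r M L C :: real
  assumes M: "0 < M" and "0 < M - L" and "0 \<le> L" and C: "0 < C" "C \<le> 1 / 32" and "0 \<le> r"
    and t: "r * M \<le> t" and u: "t - 4 * r * (C * L) \<le> u"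
  shows "t / M * (1 + L / M * (1 - 16 * C)) \<le> u / (M - L)"
proof -
  define w where "w = 1 - 16 * C"
  have w: "0 \<le> w"
    using C by (simp add: w_def)
  have t0: "0 \<le> t"
    using mult_nonneg_nonneg[OF \<open>0 \<le> r\<close>, of M] M t by linarith
  \<comment> \<open>This is the left side after clearing denominators, to be bounded by
    \<open>u\<close> times the square of \<open>M\<close>. Next the nonnegative last term is dropped
    and \<open>1 - w\<close> is replaced by \<open>16 * C\<close>.\<close>
  have "t * (M + L * w) * (M - L) = t * M\<^sup>2 - (1 - w) * (L * M) * t - t * (L\<^sup>2 * w)"
    by (simp add: algebra_simps power2_eq_square)
  also have "\<dots> \<le> t * M\<^sup>2 - 16 * (C * L * M) * t"
    using t0 w by (simp add: w_def mult.assoc)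
  also have "\<dots> \<le> t * M\<^sup>2 - 4 * (C * L * M) * (r * M)"
  proof -
    \<comment> \<open>Here \<open>r * M <= t\<close> turns the additive loss into a multiple of
      \<open>t\<close>; the passage from 4 to 16 is slack.\<close>
    have "4 * (C * L * M) * (r * M) \<le> 16 * (C * L * M) * t"
      using assms by (intro mult_mono) auto
    then show ?thesis
      by simp
  qed
  also have "\<dots> = (t - 4 * r * (C * L)) * M\<^sup>2"
    by (simp add: algebra_simps power2_eq_square)
  also have "\<dots> \<le> u * M\<^sup>2"
    using u by (intro mult_right_mono) auto
  finally have "t * (M + L * w) / M\<^sup>2 \<le> u / (M - L)"
    using assms by (simp add: pos_divide_le_eq pos_le_divide_eq)
  moreover have "t / M * (1 + L / M * w) = t * (M + L * w) / M\<^sup>2"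
    using M by (simp add: add_divide_distrib power2_eq_square distrib_left)
  ultimately show ?thesis
    by (simp add: w_def)
qed

text \<open>By the triangle inequality for roots of energies, removing a bad \<open>B\<close> of
  relative size \<open>x\<close> lowers the root of the energy by a factor of at least
  \<open>1 - C * x\<close>, whereas the cardinality falls by the factor \<open>1 - x\<close>. As
  \<open>C\<close> is small, the logarithm of the energy falls proportionally less than that of the
  cardinality.\<close>

lemma zeta_exp_increment:
  fixes A B :: "'a::ab_group_add set" and \<beta> C :: real
  assumes "finite A" "2 \<le> card A" "B \<subseteq> A" and "even k" "0 < k" and C: "0 < C" "C \<le> 1 / 32"
    and \<beta>: "0 < \<beta>" "\<beta> * card A \<le> card B" "card B < card A"
    and small: "real (T_energy k B) < C ^ (2 * k) * (card B / card A) ^ (2 * k) * T_energy k A"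
  shows "2 \<le> card (A - B)"
    and "zeta_exp k A * (1 + log 2 (inverse (1 - \<beta>)) / log 2 (card A) * (1 - 16 * C)) \<le> zeta_exp k (A - B)"
proof -
  define x where "x = real (card B) / card A"
  have x: "0 < x" "x < 1" "\<beta> \<le> x"
  proof -
    show "\<beta> \<le> x" "x < 1"
      using assms by (simp_all add: x_def pos_le_divide_eq)
    then show "0 < x"
      using \<beta> by simp
  qed
  have finB: "finite B"
    using assms finite_subset by blast
  have ne: "B \<noteq> {}" "A - B \<noteq> {}" "A \<noteq> {}"
  proof -
    show "B \<noteq> {}" "A \<noteq> {}"
      using x by (auto simp: x_def)
    show "A - B \<noteq> {}"
      using \<open>B \<subseteq> A\<close> \<open>card B < card A\<close> by (metis Diff_eq_empty_iff subset_antisym less_irrefl)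
  qed
  have card: "real (card (A - B)) = card A * (1 - x)"
    using finB \<open>B \<subseteq> A\<close> \<open>card B < card A\<close>
    by (simp add: card_Diff_subset of_nat_diff x_def right_diff_distrib)
  have pos: "0 < real (T_energy k A)" "0 < real (T_energy k (A - B))"
    using assms ne by (simp_all add: T_energy_pos)
  define a d where "a = root (2 * k) (T_energy k A)" and "d = root (2 * k) (T_energy k (A - B))"
  have pow: "a ^ (2 * k) = T_energy k A" "d ^ (2 * k) = T_energy k (A - B)"
    using assms by (simp_all add: a_def d_def)
  have "root (2 * k) (T_energy k B) \<le> root (2 * k) ((C * x * a) ^ (2 * k))"
    using small \<open>0 < k\<close> by (simp only: power_mult_distrib pow x_def) simp
  also have "\<dots> = C * x * a"
    using x C assms by (intro real_root_power_cancel) (simp_all add: a_def)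
  finally have "a \<le> C * x * a + d"
    using T_energy_root_triangle[of B "A - B" k] assms finB ne Un_Diff_cancel[of B A]
    by (simp add: a_def d_def Un_absorb1)
  then have "a * (1 - C * x) \<le> d"
    by (simp add: algebra_simps)
  moreover have Cx: "0 < C * x" "C * x \<le> 1 / 32"
    using x C mult_mono[of C "1/32" x 1] by auto
  ultimately have "(a * (1 - C * x)) ^ (2 * k) \<le> d ^ (2 * k)"
    using pos \<open>0 < k\<close> by (intro power_mono mult_nonneg_nonneg) (simp_all add: a_def)
  then have "real (T_energy k A) * (1 - C * x) ^ (2 * k) \<le> T_energy k (A - B)"
    by (simp add: power_mult_distrib pow)
  then have "ln (real (T_energy k A) * (1 - C * x) ^ (2 * k)) \<le> ln (T_energy k (A - B))"
    using pos Cx by (subst ln_le_cancel_iff) auto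
  then have ln_ge: "ln (T_energy k A) + 2 * k * ln (1 - C * x) \<le> ln (T_energy k (A - B))"
    using pos Cx by (simp add: ln_mult ln_realpow)
  \<comment> \<open>Natural logarithms may replace base 2, as the base cancels in all the
    quotients.\<close>
  define t u M L where "t = ln (real (T_energy k A))" and "u = ln (real (T_energy k (A - B)))"
    and "M = ln (real (card A))" and "L = - ln (1 - x)"
  have "x \<le> L"
    using x ln_le_minus_one[of "1 - x"] by (simp add: L_def)
  have M: "0 < M"
    using assms by (simp add: M_def)
  \<comment> \<open>For \<open>y = C * x <= 1 / 32\<close>, \<open>ln (1 - y)\<close> is at least
    \<open>- y - 2 * y * y\<close>, hence at least \<open>- 2 * y\<close>. Multiplied by
    \<open>2 * k\<close> this yields the constant 4 in \<open>exponent_growth\<close>.\<close>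
  have "- 2 * (C * L) \<le> - 2 * (C * x)"
    using \<open>x \<le> L\<close> C by simp
  also have "\<dots> \<le> - (C * x) - 2 * (C * x)\<^sup>2"
    using Cx mult_mono[of "C * x" "1/32" "C * x" "C * x"] by (simp add: power2_eq_square)
  also have "\<dots> \<le> ln (1 - C * x)"
    using Cx by (intro ln_one_minus_pos_lower_bound) auto
  finally have u: "t - 4 * real k * (C * L) \<le> u"
    using ln_ge mult_left_mono[of "- 2 * (C * L)" "ln (1 - C * x)" "2 * k"]
    by (simp add: t_def u_def mult_ac)
  have lncard: "ln (real (card (A - B))) = M - L"
    using x ne \<open>finite A\<close> by (simp add: card ln_mult M_def L_def card_gt_0_iff)
  have t: "k * M \<le> t"
    using zeta_exp_ge[OF assms(1,2), of k] M
    by (simp add: zeta_exp_def log_def t_def M_def pos_le_divide_eq)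
  have t0: "0 \<le> t"
    using t M by (meson less_imp_le mult_nonneg_nonneg of_nat_0_le_iff order_trans)
  \<comment> \<open>A one-point remainder has energy at most 1, so \<open>u <= 0\<close>, and
    \<open>L = M\<close>. The permitted loss \<open>4 * k * C * M\<close> would then have to cover
    \<open>t >= k * M\<close>, which is impossible for \<open>C <= 1 / 32\<close>.\<close>
  show two: "2 \<le> card (A - B)"
  proof (rule ccontr)
    assume "\<not> 2 \<le> card (A - B)"
    moreover have "card (A - B) \<noteq> 0"
      using ne assms(1) by (metis card_0_eq finite_Diff)
    ultimately have "card (A - B) = 1"
      by linarith
    then have "M = L" "u \<le> 0"
      using lncard T_energy_le[of "A - B" k] assms pos by (auto simp: u_def)
    then have "(real k * M) * 1 \<le> (real k * M) * (4 * C)"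
      using t u by (simp add: mult_ac)
    then have "1 \<le> 4 * C"
      using M \<open>0 < k\<close> by (simp only: mult_le_cancel_left_pos[OF mult_pos_pos] of_nat_0_less_iff)
    then show False
      using C by simp
  qed
  then have M_gt_L: "0 < M - L"
    using ln_gt_zero[of "card (A - B)"] by (simp flip: lncard)
  \<comment> \<open>\<open>L'\<close> belongs to the guaranteed proportion \<open>\<beta>\<close>,
    \<open>L\<close> to the actual proportion \<open>x >= \<beta>\<close>; the growth factor
    increases with it.\<close>
  define L' where "L' = - ln (1 - \<beta>)"
  have "L' \<le> L"
    using x by (simp add: L'_def L_def)
  have "zeta_exp k A * (1 + log 2 (inverse (1 - \<beta>)) / log 2 (card A) * (1 - 16 * C))
      = t / M * (1 + L' / M * (1 - 16 * C))"
  proof -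
    have "log 2 (inverse (1 - \<beta>)) / log 2 (card A) = L' / M"
      using x by (simp add: log_def ln_inverse L'_def M_def)
    moreover have "zeta_exp k A = t / M"
      by (simp add: zeta_exp_def log_def t_def M_def)
    ultimately show ?thesis
      by (simp only:)
  qed
  also have "\<dots> \<le> t / M * (1 + L / M * (1 - 16 * C))"
    using \<open>L' \<le> L\<close> M t0 C by (intro mult_left_mono add_left_mono mult_right_mono divide_right_mono) auto
  also have "\<dots> \<le> u / (M - L)"
    using exponent_growth[OF M M_gt_L _ C _ t u] \<open>x \<le> L\<close> x by simp
  also have "\<dots> = zeta_exp k (A - B)"
    by (simp add: zeta_exp_def log_def u_def flip: lncard)
  finally show "zeta_exp k A * (1 + log 2 (inverse (1 - \<beta>)) / log 2 (card A) * (1 - 16 * C))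
      \<le> zeta_exp k (A - B)" .
qed

section \<open>Iterated removal of bad subsets\<close>

definition connected_set :: "nat \<Rightarrow> real \<Rightarrow> real \<Rightarrow> real \<Rightarrow> 'a::ab_group_add set \<Rightarrow> bool" where
  "connected_set k \<beta>\<^sub>1 \<beta>\<^sub>2 C A \<longleftrightarrow>
    (\<forall>B \<subseteq> A. \<beta>\<^sub>1 * real (card A) \<le> real (card B) \<and> real (card B) \<le> \<beta>\<^sub>2 * real (card A) \<longrightarrow>
       real (T_energy k B) \<ge>
         C ^ (2 * k) * (real (card B) / real (card A)) ^ (2 * k) * real (T_energy k A))"

text \<open>Strong induction on the cardinality, with \<open>s\<close> counting the removals. The
  bound \<open>m\<close> stays fixed while \<open>A\<close> shrinks, so one \<kappa> serves all
  steps.\<close>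

lemma connected_subset_exists:
  fixes A :: "'a::ab_group_add set" and \<beta>\<^sub>1 \<beta>\<^sub>2 C \<kappa> :: real
  assumes "finite A" "card A \<le> m" "2 \<le> card A" and "even k" "0 < k"
    and "0 < \<beta>\<^sub>1" "\<beta>\<^sub>1 < 1" "\<beta>\<^sub>2 < 1" and "0 < C" "C \<le> 1 / 32"
    and "\<kappa> = log 2 (inverse (1 - \<beta>\<^sub>1)) / log 2 (real m) * (1 - 16 * C)" and "0 < \<kappa>"
  shows "\<exists>A' s. A' \<subseteq> A \<and> 2 \<le> card A' \<and> connected_set k \<beta>\<^sub>1 \<beta>\<^sub>2 C A' \<and>
    card A * (1 - \<beta>\<^sub>2) ^ s \<le> card A' \<and> zeta_exp k A * (1 + \<kappa>) ^ s \<le> zeta_exp k A'"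
  using assms(1-3)
proof (induction "card A" arbitrary: A rule: less_induct)
  case less
  show ?case
  proof (cases "connected_set k \<beta>\<^sub>1 \<beta>\<^sub>2 C A")
    case True
    then show ?thesis
      using less.prems by (intro exI[of _ A] exI[of _ 0]) simp
  next
    case False
    then obtain B where B: "B \<subseteq> A" "\<beta>\<^sub>1 * card A \<le> card B" "card B \<le> \<beta>\<^sub>2 * card A"
      and small: "real (T_energy k B) < C ^ (2 * k) * (card B / card A) ^ (2 * k) * T_energy k A"
      by (auto simp: connected_set_def not_le)
    have "\<beta>\<^sub>2 * real (card A) < 1 * real (card A)"
      using \<open>\<beta>\<^sub>2 < 1\<close> less.prems by (intro mult_strict_right_mono) auto
    then have "real (card B) < real (card A)"
      using B(3) by linarith
    then have lt: "card B < card A"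
      by simp
    \<comment> \<open>A nonempty \<open>B\<close> makes the cardinality drop strictly, as the
      induction requires.\<close>
    have "0 < real (card B)"
      using B(2) mult_pos_pos[of \<beta>\<^sub>1 "real (card A)"] assms less.prems by linarith
    then have "0 < card B"
      by simp
    have finB: "finite B"
      using B less.prems finite_subset by blast
    note inc = zeta_exp_increment[OF less.prems(1,3) B(1) assms(4,5,9,10,6) B(2) lt small]
    have card: "card (A - B) = card A - card B"
      using B finB by (simp add: card_Diff_subset)
    \<comment> \<open>Since \<open>card A <= m\<close>, the gain computed with \<open>card A\<close>
      is at least the uniform gain \<kappa>.\<close>
    have "log 2 (inverse (1 - \<beta>\<^sub>1)) / log 2 m * (1 - 16 * C)
        \<le> log 2 (inverse (1 - \<beta>\<^sub>1)) / log 2 (card A) * (1 - 16 * C)"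
      using assms less.prems
      by (intro mult_right_mono divide_left_mono) (auto simp: one_le_inverse_iff)
    moreover have "0 \<le> zeta_exp k A"
      using zeta_exp_ge[of A k] less.prems by linarith
    ultimately have step: "zeta_exp k A * (1 + \<kappa>) \<le> zeta_exp k (A - B)"
      using inc(2) assms(11) by (smt (verit) mult_left_mono)
    obtain A' s where A': "A' \<subseteq> A - B" "2 \<le> card A'" "connected_set k \<beta>\<^sub>1 \<beta>\<^sub>2 C A'"
      "card (A - B) * (1 - \<beta>\<^sub>2) ^ s \<le> card A'" "zeta_exp k (A - B) * (1 + \<kappa>) ^ s \<le> zeta_exp k A'"
    proof -
      have "card (A - B) < card A" "finite (A - B)" "card (A - B) \<le> m"
        using card lt \<open>0 < card B\<close> less.prems by auto
      from less.hyps[OF this inc(1)] show thesis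
        using that by blast
    qed
    have "card A * (1 - \<beta>\<^sub>2) ^ Suc s \<le> card (A - B) * (1 - \<beta>\<^sub>2) ^ s"
    proof -
      have "card A * (1 - \<beta>\<^sub>2) \<le> card (A - B)"
        using B(3) lt by (simp add: card of_nat_diff algebra_simps)
      then show ?thesis
        using assms mult_right_mono[of _ _ "(1 - \<beta>\<^sub>2) ^ s"] by (simp add: mult.assoc)
    qed
    moreover have "zeta_exp k A * (1 + \<kappa>) ^ Suc s \<le> zeta_exp k (A - B) * (1 + \<kappa>) ^ s"
      using step assms mult_right_mono[of _ _ "(1 + \<kappa>) ^ s"] by (simp add: mult.assoc)
    ultimately show ?thesis
      using A' by (intro exI[of _ A'] exI[of _ "Suc s"]) auto
  qed
qed

section \<open>Bounding the number of removals\<close>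

theorem theorem2p11:
  fixes A :: "'a::ab_group_add set"
    and m p k :: nat
    and \<zeta> \<beta>\<^sub>1 \<beta>\<^sub>2 C \<kappa> :: real
  assumes "finite A" and "card A = m" and "m \<ge> 2"
    and "p \<ge> 1" and "k = 2 ^ p"
    and "\<zeta> = zeta_exp k A"
    and "0 < \<beta>\<^sub>1" and "\<beta>\<^sub>1 < 1" and "0 < \<beta>\<^sub>2" and "\<beta>\<^sub>2 < 1" and "\<beta>\<^sub>1 \<le> \<beta>\<^sub>2"
    and "0 < C" and "C \<le> 1 / 32"
    and "\<kappa> = log 2 (inverse (1 - \<beta>\<^sub>1)) / log 2 (real m) * (1 - 16 * C)"
  shows "\<exists>A' \<subseteq> A. card A' \<ge> 2 \<and>
    (\<forall>B \<subseteq> A'. \<beta>\<^sub>1 * real (card A') \<le> real (card B) \<and> real (card B) \<le> \<beta>\<^sub>2 * real (card A') \<longrightarrow>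
       real (T_energy k B) \<ge>
         C ^ (2 * k) * (real (card B) / real (card A')) ^ (2 * k) * real (T_energy k A')) \<and>
    real (card A') \<ge>
      real m * 2 powr (log 2 ((2 * real k - 1) / \<zeta>) / log 2 (1 + \<kappa>) * log 2 (1 - \<beta>\<^sub>2)) \<and>
    zeta_exp k A' \<ge> zeta_exp k A"
proof -
  \<comment> \<open>Evenness of \<open>k\<close> comes from \<open>p >= 1\<close>.\<close>
  have A: "finite A" "card A \<le> m" "2 \<le> card A" and k: "even k" "0 < k"
    using assms by auto
  have \<kappa>: "0 < \<kappa>"
    using assms by (simp add: one_less_inverse_iff)
  \<comment> \<open>The bound \<open>2 <= card A'\<close> keeps \<open>zeta_exp k A'\<close> away
    from its default value and makes \<open>zeta_exp_le\<close> applicable.\<close>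
  obtain A' s where A': "A' \<subseteq> A" "2 \<le> card A'" "connected_set k \<beta>\<^sub>1 \<beta>\<^sub>2 C A'"
    "card A * (1 - \<beta>\<^sub>2) ^ s \<le> card A'" "zeta_exp k A * (1 + \<kappa>) ^ s \<le> zeta_exp k A'"
    using connected_subset_exists[OF A k assms(7,8,10,12,13,14) \<kappa>] by blast
  have finA': "finite A'"
    using A' A finite_subset by blast
  have \<zeta>: "0 < \<zeta>"
    using zeta_exp_ge[OF A(1,3), of k] k assms(6) by simp
  have "\<zeta> * (1 + \<kappa>) ^ s \<le> 2 * real k - 1"
    using A'(5) zeta_exp_le[OF finA' A'(2) k(2)] assms(6) by simp
  then have "(1 + \<kappa>) ^ s \<le> (2 * real k - 1) / \<zeta>"
    using \<zeta> by (simp add: pos_le_divide_eq mult.commute)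
  then have "log 2 ((1 + \<kappa>) ^ s) \<le> log 2 ((2 * real k - 1) / \<zeta>)"
    using \<kappa> by (intro log_mono) auto
  then have "real s * log 2 (1 + \<kappa>) \<le> log 2 ((2 * real k - 1) / \<zeta>)"
    using \<kappa> by (simp add: log_nat_power)
  then have s: "real s \<le> log 2 ((2 * real k - 1) / \<zeta>) / log 2 (1 + \<kappa>)" (is "_ \<le> ?E")
    using \<kappa> by (simp add: pos_le_divide_eq)
  \<comment> \<open>The logarithm of \<open>1 - \<beta>\<^sub>2\<close> is negative, so the upper
    bound on \<open>s\<close> becomes a lower bound on the surviving proportion.\<close>
  have "2 powr (?E * log 2 (1 - \<beta>\<^sub>2)) \<le> 2 powr (real s * log 2 (1 - \<beta>\<^sub>2))"
    using s assms by (intro powr_mono mult_right_mono_neg) auto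
  also have "\<dots> = (1 - \<beta>\<^sub>2) ^ s"
    using \<open>\<beta>\<^sub>2 < 1\<close> by (simp flip: log_nat_power)
  finally have "real m * 2 powr (?E * log 2 (1 - \<beta>\<^sub>2)) \<le> real m * (1 - \<beta>\<^sub>2) ^ s"
    by (simp add: mult_left_mono)
  also have "\<dots> \<le> real (card A')"
    using A' assms by simp
  finally have card: "real m * 2 powr (?E * log 2 (1 - \<beta>\<^sub>2)) \<le> real (card A')" .
  have "1 \<le> (1 + \<kappa>) ^ s"
    using \<kappa> by (simp add: one_le_power)
  then have "zeta_exp k A * 1 \<le> zeta_exp k A * (1 + \<kappa>) ^ s"
    by (rule mult_left_mono) (use \<zeta> assms(6) in simp)
  from order_trans[OF this A'(5)] have mono: "zeta_exp k A \<le> zeta_exp k A'"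
    by simp
  show ?thesis
    by (rule exI[of _ A']) (intro conjI A'(1,2) A'(3)[unfolded connected_set_def] card mono)
qed

end
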